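(* Let $r\ge 1$ and let $a_i,b_i,m_i$ be integers with $m_i\neq 0$ for $i=1,\dots,r$. The system of congruences $a_ix\equiv b_i\pmod{m_i}$, $i=1,\dots,r$, in one integer unknown $x$ has a solution if and only if both of the following hold: $\gcd(a_i,m_i)\mid b_i$ for all $i\in\{1,\dots,r\}$, and $\gcd(a_im_j,\,a_jm_i)$ divides $a_ib_j-a_jb_i$ for all $i,j\in\{1,\dots,r\}$.
   Context: By convention $\gcd(0,0)=0$, and $0$ divides an integer $k$ only if $k=0$. *)

theory Defs
  imports "HOL-Number_Theory.Number_Theory"
begin

end

theory Submission
  imports Defs
begin

text \<open>
  Dividing the \<open>i\<close>-th congruence by \<open>g i = gcd (a i) (m i)\<close> turns it into \<open>x \<equiv> c i\<close> modulo
  \<open>n i = m i div g i\<close>. The second condition then gives that \<open>gcd (n i) (n j)\<close> divides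
  \<open>\<alpha> i * \<alpha> j * (c j - c i)\<close>, where \<open>\<alpha> i = a i div g i\<close>. As \<open>\<alpha> i\<close> is coprime to \<open>n i\<close>, the factors
  \<open>\<alpha> i\<close> and \<open>\<alpha> j\<close> cancel, and the reduced system is pairwise compatible. The Chinese remainder
  theorem for moduli that need not be coprime solves it.
\<close>

text \<open>By distributivity, \<open>gcd (lcm a b) c\<close> is the lcm of \<open>gcd a c\<close>
  and \<open>gcd b c\<close>.\<close>

lemma gcd_lcm_dvd:
  fixes a b c :: "'a::factorial_semiring_gcd"
  assumes "gcd a c dvd z" and "gcd b c dvd z"
  shows "gcd (lcm a b) c dvd z"
  using assms by (simp add: gcd.commute [of _ c] gcd_lcm_distrib)

lemma gcd_Lcm_dvd:
  fixes n :: "'a \<Rightarrow> int" and k z :: int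
  assumes "finite I" and "\<And>i. i \<in> I \<Longrightarrow> gcd (n i) k dvd z"
  shows "gcd (Lcm (n ` I)) k dvd z"
  using assms by (induction I rule: finite_induct) (auto intro: gcd_lcm_dvd)

text \<open>Bezout writes \<open>gcd m n\<close> as \<open>s * m + t * n\<close>. If
  \<open>v = u + gcd m n * k\<close>, then \<open>u + m * (s * k)\<close> stays in the class of
  \<open>u\<close> modulo \<open>m\<close> and differs from \<open>v\<close> by a multiple of
  \<open>n\<close>.\<close>

lemma chinese_remainder_two_int:
  fixes m n u v :: int
  assumes "[u = v] (mod gcd m n)"
  obtains x where "[x = u] (mod m)" "[x = v] (mod n)"
proof -
  obtain k where k: "v = u + gcd m n * k"
    using assms by (auto simp: cong_iff_lin)
  obtain s t where st: "s * m + t * n = gcd m n"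
    using bezout_int by blast
  have "u + m * (s * k) - v = n * (- t * k)"
    unfolding k st [symmetric] by (simp add: algebra_simps)
  then have "[u + m * (s * k) = v] (mod n)"
    unfolding cong_iff_dvd_diff by simp
  then show thesis
    by (rule that [rotated]) (simp add: cong_iff_dvd_diff)
qed

text \<open>Induction on \<open>I\<close>: the congruences solved so far are kept when
  \<open>x\<close> changes by a multiple of the \<open>Lcm\<close> of their moduli, so adding one
  more is a problem with two moduli. Its compatibility condition reduces to the pairwise ones by
  \<open>gcd_Lcm_dvd\<close>.\<close>

lemma chinese_remainder_int:
  fixes n c :: "'a \<Rightarrow> int"
  assumes "finite I"
    and "\<And>i j. i \<in> I \<Longrightarrow> j \<in> I \<Longrightarrow> [c i = c j] (mod gcd (n i) (n j))"
  shows "\<exists>x. \<forall>i\<in>I. [x = c i] (mod n i)"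
  using assms
proof (induction I rule: finite_induct)
  case (insert k I)
  then obtain x where x: "[x = c i] (mod n i)" if "i \<in> I" for i
    by auto
  have "gcd (n i) (n k) dvd x - c k" if "i \<in> I" for i
    using cong_trans [OF cong_dvd_modulus [OF x [OF that] gcd_dvd1]] insert.prems that
    by (auto simp: cong_iff_dvd_diff)
  then have "[x = c k] (mod gcd (Lcm (n ` I)) (n k))"
    using insert.hyps(1) by (auto simp: cong_iff_dvd_diff intro: gcd_Lcm_dvd)
  then obtain y where y: "[y = x] (mod Lcm (n ` I))" "[y = c k] (mod n k)"
    by (rule chinese_remainder_two_int)
  have "[y = c i] (mod n i)" if "i \<in> I" for i
    using cong_trans [OF cong_dvd_modulus [OF y(1)] x [OF that]] that by auto
  with y(2) show ?case by auto
qed auto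

theorem theorem2:
  fixes r :: nat and a b m :: "nat \<Rightarrow> int"
  assumes "r \<ge> 1"
    and "\<forall>i\<in>{1..r}. m i \<noteq> 0"
  shows "(\<exists>x::int. \<forall>i\<in>{1..r}. [a i * x = b i] (mod m i)) \<longleftrightarrow>
    (\<forall>i\<in>{1..r}. gcd (a i) (m i) dvd b i) \<and>
    (\<forall>i\<in>{1..r}. \<forall>j\<in>{1..r}. gcd (a i * m j) (a j * m i) dvd a i * b j - a j * b i)"
    (is "?L \<longleftrightarrow> ?R1 \<and> ?R2")
proof (intro iffI conjI)
  assume ?L
  then obtain x where "[a i * x = b i] (mod m i)" if "i \<in> {1..r}" for i
    by blast
  then have "\<exists>t. b i = a i * x + m i * t" if "i \<in> {1..r}" for i
    using that by (auto simp: cong_iff_lin)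
  then obtain t where t: "b i = a i * x + m i * t i" if "i \<in> {1..r}" for i
    by metis
  then show ?R1 by auto
  show ?R2
  proof (intro ballI)
    fix i j assume "i \<in> {1..r}" "j \<in> {1..r}"
    \<comment> \<open>The terms \<open>a i * a j * x\<close> cancel.\<close>
    then have "a i * b j - a j * b i = a i * m j * t j - a j * m i * t i"
      by (simp add: t algebra_simps)
    also have "gcd (a i * m j) (a j * m i) dvd \<dots>"
      by (intro dvd_diff dvd_mult2 [of _ "_ * _"]) auto
    finally show "gcd (a i * m j) (a j * m i) dvd a i * b j - a j * b i" .
  qed
next
  assume R: "?R1 \<and> ?R2"
  define g where "g i = gcd (a i) (m i)" for i
  define \<alpha> \<beta> n where "\<alpha> i = a i div g i" and "\<beta> i = b i div g i" and "n i = m i div g i" for i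
  have g0: "g i \<noteq> 0" if "i \<in> {1..r}" for i
    using assms that by (auto simp: g_def)
  have eqs: "a i = g i * \<alpha> i" "m i = g i * n i" "b i = g i * \<beta> i" if "i \<in> {1..r}" for i
    using R that by (auto simp: \<alpha>_def \<beta>_def n_def g_def)
  have cop: "coprime (\<alpha> i) (n i)" if "i \<in> {1..r}" for i
    using g0 [OF that] unfolding \<alpha>_def n_def g_def by (intro div_gcd_coprime) auto
  \<comment> \<open>Here \<open>c\<close> is \<open>y * \<beta> i\<close>, where \<open>y\<close> is
    an inverse of \<open>\<alpha> i\<close> modulo \<open>n i\<close>.\<close>
  have "\<exists>c t. \<beta> i = \<alpha> i * c + n i * t" if i: "i \<in> {1..r}" for i
  proof -
    obtain y where "[\<alpha> i * y = 1] (mod n i)"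
      using cong_solve_coprime_int [OF cop [OF i]] by blast
    then have "[\<alpha> i * (y * \<beta> i) = \<beta> i] (mod n i)"
      using cong_scalar_right [of "\<alpha> i * y" 1 "n i" "\<beta> i"] by (simp add: mult.assoc)
    then show ?thesis by (auto simp: cong_iff_lin)
  qed
  then obtain c t where ct: "\<beta> i = \<alpha> i * c i + n i * t i" if "i \<in> {1..r}" for i
    by metis
  have "[c i = c j] (mod gcd (n i) (n j))" if i: "i \<in> {1..r}" and j: "j \<in> {1..r}" for i j
  proof -
    let ?d = "gcd (n i) (n j)"
    \<comment> \<open>After factoring out \<open>g i * g j\<close>, the two products keep the
      factors \<open>n j\<close> and \<open>n i\<close>, both multiples of
      \<open>?d\<close>.\<close>
    have "g i * g j * ?d dvd gcd (a i * m j) (a j * m i)"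
      unfolding eqs [OF i] eqs [OF j]
      by (auto intro!: gcd_greatest mult_dvd_mono simp: mult.commute mult.left_commute)
    also have "\<dots> dvd a i * b j - a j * b i"
      using R i j by blast
    also have "\<dots> = g i * g j * (\<alpha> i * \<beta> j - \<alpha> j * \<beta> i)"
      unfolding eqs [OF i] eqs [OF j] by (simp add: algebra_simps)
    finally have "?d dvd \<alpha> i * \<beta> j - \<alpha> j * \<beta> i"
      using g0 [OF i] g0 [OF j] by simp
    \<comment> \<open>Modulo \<open>?d\<close> the terms with \<open>n i\<close> and
      \<open>n j\<close> vanish, which leaves only the difference of the residues
      \<open>c\<close>.\<close>
    also have "\<alpha> i * \<beta> j - \<alpha> j * \<beta> i
      = \<alpha> i * (\<alpha> j * (c j - c i)) + (n j * (\<alpha> i * t j) - n i * (\<alpha> j * t i))"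
      unfolding ct [OF i] ct [OF j] by (simp add: algebra_simps)
    finally have "?d dvd \<alpha> i * (\<alpha> j * (c j - c i))"
      by (subst (asm) dvd_add_left_iff) (auto intro!: dvd_diff dvd_mult2)
    moreover have "coprime ?d (\<alpha> i)" "coprime ?d (\<alpha> j)"
      using cop [OF i] cop [OF j]
      by (meson coprime_commute coprime_divisors dvd_refl gcd_dvd1 gcd_dvd2)+
    ultimately have "?d dvd c j - c i"
      by (simp add: coprime_dvd_mult_right_iff)
    then show ?thesis
      by (simp add: cong_iff_dvd_diff dvd_diff_commute)
  qed
  then obtain x where x: "[x = c i] (mod n i)" if "i \<in> {1..r}" for i
    using chinese_remainder_int [of "{1..r}" c n] by (metis finite_atLeastAtMost)
  have "[a i * x = b i] (mod m i)" if i: "i \<in> {1..r}" for i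
  proof -
    obtain s where "c i = x + n i * s"
      using x [OF i] by (auto simp: cong_iff_lin)
    \<comment> \<open>Multiplying the reduced congruence by \<open>g i\<close> restores the modulus
      \<open>m i = g i * n i\<close>.\<close>
    then have "b i - a i * x = m i * (\<alpha> i * s + t i)"
      unfolding eqs [OF i] ct [OF i] by (simp add: algebra_simps)
    then show ?thesis
      by (metis cong_iff_dvd_diff cong_sym dvd_triv_left)
  qed
  then show ?L by blast
qed

end
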